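(* Let $p_1,p_2\in(0,\infty)$ with $p_1<p_2$, and let $\varphi:\mathbb{R}^n\times[0,\infty)\to[0,\infty)$ be a Musielak-Orlicz function of uniformly lower type $p_\varphi^-$ and of uniformly upper type $p_\varphi^+$. Assume that $0<p_1<p_\varphi^-\le p_\varphi^+<p_2<\infty$ and that $T$ is a sublinear operator defined on $L^{p_1}_{\varphi(\cdot,1)}(\mathbb{R}^n)+L^{p_2}_{\varphi(\cdot,1)}(\mathbb{R}^n)$ such that, for each $i\in\{1,2\}$, there is a positive constant $C_i$ with $$\varphi(\{x\in\mathbb{R}^n:\ |Tf(x)|>\alpha\},t)\le C_i\,\alpha^{-p_i}\int_{\mathbb{R}^n}|f(x)|^{p_i}\varphi(x,t)\,dx$$ for all $\alpha\in(0,\infty)$, all $t\in(0,\infty)$ and all $f\in L^{p_i}_{\varphi(\cdot,1)}(\mathbb{R}^n)$, where $C_i$ is independent of $f$, $t$ and $\alpha$. Then $T$ is bounded on $L^\varphi(\mathbb{R}^n)$ and, moreover, there exists a positive constant $C$ such that, for all $f\in L^\varphi(\mathbb{R}^n)$, $$\int_{\mathbb{R}^n}\varphi(x,|Tf(x)|)\,dx\le C\int_{\mathbb{R}^n}\varphi(x,|f(x)|)\,dx.$$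
   Context: An Orlicz function is a nondecreasing function $\Phi:[0,\infty)\to[0,\infty)$ with $\Phi(0)=0$, $\Phi(t)>0$ for $t\in(0,\infty)$ and $\lim_{t\to\infty}\Phi(t)=\infty$. A function $\varphi:\mathbb{R}^n\times[0,\infty)\to[0,\infty)$ is a Musielak-Orlicz function if $\varphi(x,\cdot)$ is an Orlicz function for every $x\in\mathbb{R}^n$ and $\varphi(\cdot,t)$ is measurable for every $t\in[0,\infty)$. It is of uniformly upper type $p$ (resp. uniformly lower type $p$), $p\in[0,\infty)$, if there is a positive constant $C$ such that $\varphi(x,st)\le Cs^p\varphi(x,t)$ for all $x\in\mathbb{R}^n$, $t\in[0,\infty)$ and $s\in[1,\infty)$ (resp. $s\in[0,1]$). For measurable $E\subset\mathbb{R}^n$ and $t\in[0,\infty)$, $\varphi(E,t):=\int_E\varphi(x,t)\,dx$. For $p\in(0,\infty)$, $L^p_{\varphi(\cdot,1)}(\mathbb{R}^n)$ is the space of measurable functions $f$ with $\int_{\mathbb{R}^n}|f(x)|^p\varphi(x,1)\,dx<\infty$. The Musielak-Orlicz space $L^\varphi(\mathbb{R}^n)$ is the space of all measurable $f$ with $\int_{\mathbb{R}^n}\varphi(x,|f(x)|)\,dx<\infty$, equipped with $\|f\|_{L^\varphi(\mathbb{R}^n)}:=\inf\{\lambda\in(0,\infty):\int_{\mathbb{R}^n}\varphi(x,|f(x)|/\lambda)\,dx\le1\}$. *)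

theory Defs
  imports "HOL-Analysis.Analysis"
begin

definition orlicz_function :: "(real \<Rightarrow> real) \<Rightarrow> bool" where
  "orlicz_function \<Phi> \<longleftrightarrow>
     mono_on {0..} \<Phi> \<and> \<Phi> 0 = 0 \<and> (\<forall>t>0. \<Phi> t > 0) \<and> filterlim \<Phi> at_top at_top"

text \<open>Throughout, only the values of \<open>\<phi> x t\<close> at \<open>t \<ge> 0\<close> matter, and ``measurable'' means
  Lebesgue measurable.\<close>

definition musielak_orlicz_function :: "(real ^ 'n \<Rightarrow> real \<Rightarrow> real) \<Rightarrow> bool" where
  "musielak_orlicz_function \<phi> \<longleftrightarrow>
     (\<forall>x. orlicz_function (\<phi> x)) \<and> (\<forall>t\<ge>0. (\<lambda>x. \<phi> x t) \<in> borel_measurable lebesgue)"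

definition uniformly_upper_type :: "(real ^ 'n \<Rightarrow> real \<Rightarrow> real) \<Rightarrow> real \<Rightarrow> bool" where
  "uniformly_upper_type \<phi> p \<longleftrightarrow>
     (\<exists>C>0. \<forall>x. \<forall>t\<ge>0. \<forall>s\<ge>1. \<phi> x (s * t) \<le> C * s powr p * \<phi> x t)"

definition uniformly_lower_type :: "(real ^ 'n \<Rightarrow> real \<Rightarrow> real) \<Rightarrow> real \<Rightarrow> bool" where
  "uniformly_lower_type \<phi> p \<longleftrightarrow>
     (\<exists>C>0. \<forall>x. \<forall>t\<ge>0. \<forall>s\<in>{0..1}. \<phi> x (s * t) \<le> C * s powr p * \<phi> x t)"

definition phi_measure :: "(real ^ 'n \<Rightarrow> real \<Rightarrow> real) \<Rightarrow> (real ^ 'n) set \<Rightarrow> real \<Rightarrow> ennreal" where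
  "phi_measure \<phi> E t = (\<integral>\<^sup>+x\<in>E. ennreal (\<phi> x t) \<partial>lebesgue)"

text \<open>Function spaces consist of functions rather than of almost-everywhere classes. The scalars
  are any type in the sorts below, so that real- and complex-valued functions are both covered.\<close>

definition weighted_Lp ::
    "real \<Rightarrow> (real ^ 'n \<Rightarrow> real) \<Rightarrow> (real ^ 'n \<Rightarrow> 'k::{real_normed_field,euclidean_space}) set" where
  "weighted_Lp p w =
     {f \<in> borel_measurable lebesgue. (\<integral>\<^sup>+x. ennreal (norm (f x) powr p * w x) \<partial>lebesgue) < \<infinity>}"

definition space_sum ::
    "(real ^ 'n \<Rightarrow> 'k::{real_normed_field,euclidean_space}) set \<Rightarrow> (real ^ 'n \<Rightarrow> 'k) set
      \<Rightarrow> (real ^ 'n \<Rightarrow> 'k) set" where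
  "space_sum V W = {(\<lambda>x. g x + h x) | g h. g \<in> V \<and> h \<in> W}"

text \<open>An Orlicz function need not be continuous, so \<open>x \<mapsto> \<phi> x (norm (f x))\<close> can fail to be
  measurable. The nonnegative integral is then a lower integral; it is the usual Lebesgue integral
  whenever the integrand is measurable.\<close>

definition modular ::
    "(real ^ 'n \<Rightarrow> real \<Rightarrow> real) \<Rightarrow> (real ^ 'n \<Rightarrow> 'k::{real_normed_field,euclidean_space}) \<Rightarrow> ennreal" where
  "modular \<phi> f = (\<integral>\<^sup>+x. ennreal (\<phi> x (norm (f x))) \<partial>lebesgue)"

definition musielak_orlicz_space ::
    "(real ^ 'n \<Rightarrow> real \<Rightarrow> real) \<Rightarrow> (real ^ 'n \<Rightarrow> 'k::{real_normed_field,euclidean_space}) set" where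
  "musielak_orlicz_space \<phi> = {f \<in> borel_measurable lebesgue. modular \<phi> f < \<infinity>}"

text \<open>Taken in \<open>ennreal\<close>, so that the infimum of the empty set is \<open>\<infinity>\<close>.\<close>

definition musielak_orlicz_norm ::
    "(real ^ 'n \<Rightarrow> real \<Rightarrow> real) \<Rightarrow> (real ^ 'n \<Rightarrow> 'k::{real_normed_field,euclidean_space}) \<Rightarrow> ennreal" where
  "musielak_orlicz_norm \<phi> f =
     Inf {ennreal r | r. r > 0 \<and> (\<integral>\<^sup>+x. ennreal (\<phi> x (norm (f x) / r)) \<partial>lebesgue) \<le> 1}"

text \<open>An operator defined on \<open>V\<close> is a total function on functions whose values outside \<open>V\<close> are
  irrelevant. Operators act modulo null sets, so the pointwise conditions are required
  almost everywhere only.\<close>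

definition sublinear_operator_on ::
    "(real ^ 'n \<Rightarrow> 'k::{real_normed_field,euclidean_space}) set
      \<Rightarrow> ((real ^ 'n \<Rightarrow> 'k) \<Rightarrow> (real ^ 'n \<Rightarrow> 'k)) \<Rightarrow> bool" where
  "sublinear_operator_on V T \<longleftrightarrow>
     (\<forall>f\<in>V. T f \<in> borel_measurable lebesgue) \<and>
     (\<forall>f\<in>V. \<forall>g\<in>V. AE x in lebesgue. norm (T (\<lambda>y. f y + g y) x) \<le> norm (T f x) + norm (T g x)) \<and>
     (\<forall>f\<in>V. \<forall>c. AE x in lebesgue. norm (T (\<lambda>y. c * f y) x) = norm c * norm (T f x))"

definition bounded_on_musielak_orlicz_space ::
    "(real ^ 'n \<Rightarrow> real \<Rightarrow> real)
      \<Rightarrow> ((real ^ 'n \<Rightarrow> 'k::{real_normed_field,euclidean_space}) \<Rightarrow> (real ^ 'n \<Rightarrow> 'k)) \<Rightarrow> bool" where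
  "bounded_on_musielak_orlicz_space \<phi> T \<longleftrightarrow>
     (\<exists>C>0. \<forall>f\<in>musielak_orlicz_space \<phi>.
        T f \<in> musielak_orlicz_space \<phi> \<and>
        musielak_orlicz_norm \<phi> (T f) \<le> ennreal C * musielak_orlicz_norm \<phi> f)"

end

theory Submission
  imports Defs
begin

text \<open>This is Marcinkiewicz interpolation between the weak types \<open>p1\<close> and \<open>p2\<close>, carried out on a
  dyadic scale. Write \<open>u\<close> for a value of \<open>norm (f x)\<close>. By the upper type, \<open>\<phi> x v\<close> is at most a constant
  times the sum over all integers \<open>k\<close> with \<open>2\<^sup>k < v\<close> of \<open>\<phi> x 2\<^sup>k\<close> (\<open>orlicz_le_dyadic_sum\<close>). Hence the
  modular of \<open>T f\<close> is controlled by the sum over \<open>k\<close> of the \<open>\<phi>(\<cdot>, 2\<^sup>k)\<close>-measures of the level sets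
  \<open>{norm (T f) > 2\<^sup>k}\<close>. At each height \<open>t = 2\<^sup>k\<close> cut \<open>f\<close> into the part where \<open>norm f > t\<close>, to which weak
  type \<open>p1\<close> applies, and the rest, to which weak type \<open>p2\<close> applies. Both contributions together are at most
  a constant times the integral of \<open>w (u / t) * \<phi> x t\<close>, where \<open>w r\<close> is \<open>(2 * r) powr p1\<close> for \<open>r > 1\<close> and
  \<open>(2 * r) powr p2\<close> otherwise (\<open>distribution_le_split_weight\<close>).

  What makes the sum over \<open>k\<close> converge is the gap between the exponents. For \<open>t < u\<close> the lower type
  bounds \<open>\<phi> x t / \<phi> x u\<close> by a constant times the power of \<open>t / u\<close> with the lower type as exponent, which
  beats \<open>(u / t) powr p1\<close>; for \<open>t \<ge> u\<close> the upper
  type lets \<open>\<phi> x t\<close> grow more slowly than \<open>(u / t) powr p2\<close> decays. So \<open>w (u / t) * \<phi> x t\<close> is at most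
  a constant times \<open>\<phi> x u\<close> times a factor that decays exponentially in the distance between \<open>log 2 t\<close> and \<open>log 2 u\<close>
  (\<open>split_weight_decay\<close>), and the sum over \<open>t = 2\<^sup>k\<close> is a two-sided geometric series with a bound
  independent of \<open>u\<close>. This gives the modular inequality. The norm inequality follows by applying it
  to \<open>f / r\<close> and absorbing the constant into the argument of \<open>\<phi>\<close> with the lower type, which is positive.

  The composition \<open>x \<mapsto> \<phi> x (norm (f x))\<close> may be nonmeasurable, and its integral is then a lower
  integral. The dyadic sums are measurable, being built from the functions \<open>\<phi>(\<cdot>, 2\<^sup>k)\<close>, so every use of
  additivity or of Tonelli takes place there; the nonmeasurable integrands are only compared by
  monotonicity and multiplied by constants (\<open>nn_integral_cmult_le_lower\<close>).\<close>

section \<open>Lower integrals and geometric sums\<close>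

text \<open>Even for nonmeasurable \<open>g\<close> the integral is the supremum of the integrals of the simple functions below
  \<open>g\<close>, and dividing by \<open>c\<close> maps the simple functions below \<open>c * g\<close> to those below \<open>g\<close>.\<close>

lemma nn_integral_cmult_le_lower:
  fixes c :: real
  assumes "c > 0"
  shows "(\<integral>\<^sup>+x. ennreal c * g x \<partial>M) \<le> ennreal c * (\<integral>\<^sup>+x. g x \<partial>M)"
proof -
  have "integral\<^sup>S M h \<le> ennreal c * (\<integral>\<^sup>+x. g x \<partial>M)"
    if h: "simple_function M h" "h \<le> (\<lambda>x. ennreal c * g x)" for h
  proof -
    have inv: "ennreal c * (ennreal (1 / c) * y) = y" "ennreal (1 / c) * (ennreal c * y) = y" for y
      using assms by (simp_all add: mult.assoc[symmetric] ennreal_mult[symmetric])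
    have [measurable]: "h \<in> borel_measurable M"
      using h(1) by (rule borel_measurable_simple_function)
    have "integral\<^sup>S M h = (\<integral>\<^sup>+x. ennreal c * (ennreal (1 / c) * h x) \<partial>M)"
      using h(1) by (simp add: inv nn_integral_eq_simple_integral)
    also have "\<dots> = ennreal c * (\<integral>\<^sup>+x. ennreal (1 / c) * h x \<partial>M)"
      by (rule nn_integral_cmult) measurable
    also have "(\<integral>\<^sup>+x. ennreal (1 / c) * h x \<partial>M) \<le> (\<integral>\<^sup>+x. g x \<partial>M)"
    proof (rule nn_integral_mono)
      fix x
      have "ennreal (1 / c) * h x \<le> ennreal (1 / c) * (ennreal c * g x)"
        using h(2) by (intro mult_left_mono) (auto simp: le_fun_def)
      then show "ennreal (1 / c) * h x \<le> g x"
        by (simp add: inv)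
    qed
    finally show ?thesis
      by (simp add: mult_left_mono)
  qed
  then show ?thesis
    unfolding nn_integral_def[of M "\<lambda>x. ennreal c * g x"] by (intro SUP_least) auto
qed

text \<open>The bound is uniform in \<open>a\<close> because \<open>a\<close> may be replaced by its floor at the cost of a factor
  \<open>2 powr \<epsilon>\<close>; what remains is two copies of a geometric series.\<close>

lemma two_sided_geometric_sum_bounded:
  fixes \<epsilon> :: real
  assumes "\<epsilon> > 0"
  shows "\<exists>K>0. \<forall>a. (\<integral>\<^sup>+k. ennreal (2 powr (- \<epsilon> * \<bar>real_of_int k - a\<bar>)) \<partial>count_space UNIV) \<le> ennreal K"
proof -
  define K where "K = 2 powr \<epsilon> / (1 - 2 powr - \<epsilon>)"
  have q: "2 powr - \<epsilon> < 1"
    using assms powr_less_mono[of "- \<epsilon>" 0 2] by simp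
  have K: "K > 0"
    using q unfolding K_def by (intro divide_pos_pos) auto
  \<comment> \<open>Used for the integers on either side of \<open>\<lfloor>a\<rfloor>\<close>; the shift by 1 absorbs the fractional part of \<open>a\<close>.\<close>
  have half: "(\<integral>\<^sup>+n. ennreal (2 powr (- \<epsilon> * \<bar>real_of_int (i n) - a\<bar>)) \<partial>count_space UNIV) \<le> ennreal K"
    if i: "\<And>n. real n - 1 \<le> \<bar>real_of_int (i n) - a\<bar>" for i :: "nat \<Rightarrow> int" and a :: real
  proof -
    have "(\<integral>\<^sup>+n. ennreal (2 powr (- \<epsilon> * \<bar>real_of_int (i n) - a\<bar>)) \<partial>count_space UNIV)
        \<le> (\<integral>\<^sup>+n. ennreal (2 powr \<epsilon> * (2 powr - \<epsilon>) ^ n) \<partial>count_space UNIV)"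
    proof (intro nn_integral_mono ennreal_leI)
      fix n
      have "- \<epsilon> * \<bar>real_of_int (i n) - a\<bar> \<le> - \<epsilon> * (real n - 1)"
        using i[of n] assms by (intro mult_left_mono_neg) auto
      then have "2 powr (- \<epsilon> * \<bar>real_of_int (i n) - a\<bar>) \<le> 2 powr (\<epsilon> + (- \<epsilon>) * real n)"
        by (intro powr_mono) (auto simp: algebra_simps)
      also have "\<dots> = 2 powr \<epsilon> * (2 powr - \<epsilon>) ^ n"
        unfolding powr_add powr_powr[symmetric] by (simp add: powr_realpow del: powr_powr)
      finally show "2 powr (- \<epsilon> * \<bar>real_of_int (i n) - a\<bar>) \<le> 2 powr \<epsilon> * (2 powr - \<epsilon>) ^ n" .
    qed
    also have "\<dots> = ennreal K"
    proof -
      have "(\<lambda>n. (2 powr - \<epsilon>) ^ n) sums (1 / (1 - 2 powr - \<epsilon>))"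
        using q by (intro geometric_sums) simp
      from sums_mult[OF this, of "2 powr \<epsilon>"]
      have "(\<lambda>n. 2 powr \<epsilon> * (2 powr - \<epsilon>) ^ n) sums K"
        by (simp add: K_def)
      then show ?thesis
        unfolding nn_integral_count_space_nat
        by (intro suminf_ennreal_eq) auto
    qed
    finally show ?thesis .
  qed
  have "(\<integral>\<^sup>+k. ennreal (2 powr (- \<epsilon> * \<bar>real_of_int k - a\<bar>)) \<partial>count_space UNIV) \<le> ennreal (2 * K)" for a
  proof -
    define g where "g k = ennreal (2 powr (- \<epsilon> * \<bar>real_of_int k - a\<bar>))" for k :: int
    define j where "j = \<lfloor>a\<rfloor>"
    have j: "real_of_int j \<le> a" "a < real_of_int j + 1"
      by (auto simp: j_def)
    have up: "bij_betw (\<lambda>n. j + int n) UNIV {j..}"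
      by (rule bij_betwI[where g = "\<lambda>k. nat (k - j)"]) auto
    have down: "bij_betw (\<lambda>n. j - int n) UNIV {..j}"
      by (rule bij_betwI[where g = "\<lambda>k. nat (j - k)"]) auto
    have "(\<integral>\<^sup>+k. g k \<partial>count_space UNIV)
        \<le> (\<integral>\<^sup>+k. g k * indicator {j..} k + g k * indicator {..j} k \<partial>count_space UNIV)"
      by (intro nn_integral_mono) (auto simp: indicator_def)
    also have "\<dots> = (\<integral>\<^sup>+k. g k \<partial>count_space {j..}) + (\<integral>\<^sup>+k. g k \<partial>count_space {..j})"
      by (simp add: nn_integral_add nn_integral_count_space_indicator)
    also have "\<dots> = (\<integral>\<^sup>+n. g (j + int n) \<partial>count_space UNIV) + (\<integral>\<^sup>+n. g (j - int n) \<partial>count_space UNIV)"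
      by (simp only: nn_integral_bij_count_space[OF up] nn_integral_bij_count_space[OF down])
    also have "\<dots> \<le> ennreal K + ennreal K"
      unfolding g_def using j by (intro add_mono half) auto
    also have "\<dots> = ennreal (2 * K)"
      using K by (simp flip: ennreal_plus)
    finally show ?thesis
      by (simp add: g_def)
  qed
  then show ?thesis
    using K by (intro exI[of _ "2 * K"]) auto
qed

section \<open>Dyadic estimates for Orlicz functions\<close>

lemma dyadic_shell:
  fixes u :: real
  assumes "u > 0"
  obtains k :: int where "2 powr real_of_int k < u" "u \<le> 2 * 2 powr real_of_int k"
proof
  define k where "k = \<lceil>log 2 u\<rceil> - 1"
  have k: "real_of_int k < log 2 u" "log 2 u \<le> real_of_int k + 1"
    by (auto simp: k_def) linarith+
  show "2 powr real_of_int k < u"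
    using k(1) assms by (simp add: less_log_iff)
  have "u \<le> 2 powr (real_of_int k + 1)"
    using k(2) assms by (simp add: log_le_iff)
  then show "u \<le> 2 * 2 powr real_of_int k"
    by (simp add: powr_add mult.commute)
qed

lemma orlicz_nonneg: "orlicz_function \<Phi> \<Longrightarrow> t \<ge> 0 \<Longrightarrow> \<Phi> t \<ge> 0"
  unfolding orlicz_function_def by (metis less_eq_real_def)

lemma orlicz_mono: "orlicz_function \<Phi> \<Longrightarrow> 0 \<le> s \<Longrightarrow> s \<le> t \<Longrightarrow> \<Phi> s \<le> \<Phi> t"
  unfolding orlicz_function_def by (auto elim!: mono_onD)

text \<open>Already the term of the dyadic shell containing \<open>u\<close> suffices: passing from \<open>2 powr k\<close> to
  \<open>u \<le> 2 * 2 powr k\<close> costs one doubling, which the upper type controls.\<close>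

lemma orlicz_le_dyadic_sum:
  assumes orl: "orlicz_function \<Phi>"
    and up: "\<And>t s. t \<ge> 0 \<Longrightarrow> s \<ge> 1 \<Longrightarrow> \<Phi> (s * t) \<le> B * s powr pu * \<Phi> t" and "B > 0" "u \<ge> 0"
  shows "ennreal (\<Phi> u) \<le> ennreal (B * 2 powr pu) *
    (\<integral>\<^sup>+k. ennreal (\<Phi> (2 powr real_of_int k)) * indicator {2 powr real_of_int k<..} u \<partial>count_space UNIV)"
proof (cases "u = 0")
  case True
  then show ?thesis
    using orl by (simp add: orlicz_function_def)
next
  case False
  with \<open>u \<ge> 0\<close> obtain k :: int where k: "2 powr real_of_int k < u" "u \<le> 2 * 2 powr real_of_int k"
    using dyadic_shell[of u] by auto
  let ?F = "\<lambda>k. ennreal (\<Phi> (2 powr real_of_int k)) * indicator {2 powr real_of_int k<..} u"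
  have "\<Phi> u \<le> \<Phi> (2 * 2 powr real_of_int k)"
    using k \<open>u \<ge> 0\<close> by (intro orlicz_mono[OF orl])
  also have "\<dots> \<le> B * 2 powr pu * \<Phi> (2 powr real_of_int k)"
    by (intro up) auto
  finally have "ennreal (\<Phi> u) \<le> ennreal (B * 2 powr pu * \<Phi> (2 powr real_of_int k))"
    by (rule ennreal_leI)
  also have "\<dots> = ennreal (B * 2 powr pu) * ?F k"
    using k \<open>B > 0\<close> orlicz_nonneg[OF orl] by (simp add: ennreal_mult)
  also have "?F k = (\<integral>\<^sup>+i. ?F k * indicator {k} i \<partial>count_space UNIV)"
    by simp
  also have "\<dots> \<le> (\<integral>\<^sup>+i. ?F i \<partial>count_space UNIV)"
    by (intro nn_integral_mono) (auto simp: indicator_def)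
  finally show ?thesis
    by (simp add: mult_left_mono)
qed

text \<open>Up to constants, the weight with which a value \<open>u\<close> of \<open>norm f\<close> enters the two weak type bounds
  when \<open>f\<close> is cut at height \<open>t\<close> and \<open>r = u / t\<close>. The factor 2 arises because each of the two
  parts is responsible for half of the level \<open>t\<close>.\<close>

definition split_weight :: "real \<Rightarrow> real \<Rightarrow> real \<Rightarrow> real" where
  "split_weight p1 p2 r = (if r > 1 then (2 * r) powr p1 else (2 * r) powr p2)"

lemma split_weight_nonneg [simp]: "split_weight p1 p2 r \<ge> 0"
  by (simp add: split_weight_def)

lemma split_weight_measurable [measurable]: "split_weight p1 p2 \<in> borel_measurable borel"
  unfolding split_weight_def by measurable

text \<open>For \<open>u > t\<close> the lower type turns the weight into \<open>(t / u) powr (pl - p1)\<close>, and for \<open>u \<le> t\<close> the upper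
  type turns it into \<open>(u / t) powr (p2 - pu)\<close>. Both are at most the stated exponential as long as \<open>\<epsilon>\<close>
  does not exceed either gap.\<close>

lemma split_weight_decay:
  assumes orl: "orlicz_function \<Phi>"
    and low: "\<And>t s. t \<ge> 0 \<Longrightarrow> s \<in> {0..1} \<Longrightarrow> \<Phi> (s * t) \<le> A * s powr pl * \<Phi> t" and "A > 0"
    and up: "\<And>t s. t \<ge> 0 \<Longrightarrow> s \<ge> 1 \<Longrightarrow> \<Phi> (s * t) \<le> B * s powr pu * \<Phi> t" and "B > 0"
    and \<epsilon>: "\<epsilon> \<le> pl - p1" "\<epsilon> \<le> p2 - pu"
    and "t > 0" "u \<ge> 0"
  shows "split_weight p1 p2 (u / t) * \<Phi> t
    \<le> (2 powr p1 * A + 2 powr p2 * B) * 2 powr (- \<epsilon> * \<bar>log 2 t - log 2 u\<bar>) * \<Phi> u"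
proof (cases "u = 0")
  case True
  then show ?thesis
    using orl by (simp add: split_weight_def orlicz_function_def)
next
  case False
  with \<open>u \<ge> 0\<close> have u: "u > 0" by simp
  have \<Phi>u: "\<Phi> u \<ge> 0"
    using orlicz_nonneg[OF orl] u by simp
  define d where "d = \<bar>log 2 t - log 2 u\<bar>"
  show ?thesis
  proof (cases "u > t")
    case True
    have "log 2 t < log 2 u"
      using True \<open>t > 0\<close> u by simp
    then have tu: "t / u = 2 powr (- d)" "u / t = 2 powr d"
      using \<open>t > 0\<close> u by (simp_all add: d_def powr_diff)
    have d: "d \<ge> 0" by (simp add: d_def)
    have "\<Phi> t = \<Phi> ((t / u) * u)"
      using u by simp
    also have "\<dots> \<le> A * (t / u) powr pl * \<Phi> u"
      using True \<open>t > 0\<close> u by (intro low) auto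
    finally have "split_weight p1 p2 (u / t) * \<Phi> t \<le> (2 * (u / t)) powr p1 * (A * (t / u) powr pl * \<Phi> u)"
      using True \<open>t > 0\<close> u by (auto simp: split_weight_def intro!: mult_left_mono)
    also have "\<dots> = 2 powr p1 * A * (2 powr (d * p1) * 2 powr (- d * pl)) * \<Phi> u"
      unfolding tu by (simp only: powr_mult powr_powr mult_ac)
    also have "\<dots> = 2 powr p1 * A * 2 powr (- (pl - p1) * d) * \<Phi> u"
      by (simp add: powr_add[symmetric] algebra_simps)
    also have "\<dots> \<le> (2 powr p1 * A + 2 powr p2 * B) * 2 powr (- \<epsilon> * d) * \<Phi> u"
      using \<epsilon> d \<Phi>u \<open>A > 0\<close> \<open>B > 0\<close>
      by (intro mult_right_mono mult_mono powr_mono) auto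
    finally show ?thesis
      by (simp add: d_def)
  next
    case False
    have "log 2 u \<le> log 2 t"
      using False \<open>t > 0\<close> u by simp
    then have tu: "t / u = 2 powr d" "u / t = 2 powr (- d)"
      using \<open>t > 0\<close> u by (simp_all add: d_def powr_diff)
    have d: "d \<ge> 0" by (simp add: d_def)
    have "\<Phi> t = \<Phi> ((t / u) * u)"
      using u by simp
    also have "\<dots> \<le> B * (t / u) powr pu * \<Phi> u"
      using False \<open>t > 0\<close> u by (intro up) auto
    finally have "split_weight p1 p2 (u / t) * \<Phi> t \<le> (2 * (u / t)) powr p2 * (B * (t / u) powr pu * \<Phi> u)"
      using False \<open>t > 0\<close> u by (auto simp: split_weight_def intro!: mult_left_mono)
    also have "\<dots> = 2 powr p2 * B * (2 powr (- d * p2) * 2 powr (d * pu)) * \<Phi> u"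
      unfolding tu by (simp only: powr_mult powr_powr mult_ac)
    also have "\<dots> = 2 powr p2 * B * 2 powr (- (p2 - pu) * d) * \<Phi> u"
      by (simp add: powr_add[symmetric] algebra_simps)
    also have "\<dots> \<le> (2 powr p1 * A + 2 powr p2 * B) * 2 powr (- \<epsilon> * d) * \<Phi> u"
      using \<epsilon> d \<Phi>u \<open>A > 0\<close> \<open>B > 0\<close>
      by (intro mult_right_mono mult_mono powr_mono) auto
    finally show ?thesis
      by (simp add: d_def)
  qed
qed

text \<open>Two consequences of the decay: the pointwise bound puts the truncations of \<open>f\<close> into the weighted
  Lebesgue spaces, the bound on the dyadic sum yields the modular inequality.\<close>

lemma split_weight_bound:
  fixes \<phi> :: "real ^ 'n \<Rightarrow> real \<Rightarrow> real"
  assumes mo: "musielak_orlicz_function \<phi>"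
    and low: "uniformly_lower_type \<phi> pl" and up: "uniformly_upper_type \<phi> pu"
    and p: "p1 < pl" "pu < p2"
  shows "\<exists>K>0. (\<forall>x. \<forall>t>0. \<forall>u\<ge>0. split_weight p1 p2 (u / t) * \<phi> x t \<le> K * \<phi> x u) \<and>
    (\<forall>x. \<forall>u\<ge>0.
      (\<integral>\<^sup>+k. ennreal (split_weight p1 p2 (u / 2 powr real_of_int k) * \<phi> x (2 powr real_of_int k)) \<partial>count_space UNIV)
        \<le> ennreal (K * \<phi> x u))"
proof -
  have orl: "orlicz_function (\<phi> x)" for x
    using mo by (simp add: musielak_orlicz_function_def)
  obtain A where A: "A > 0" "\<And>x t s. t \<ge> 0 \<Longrightarrow> s \<in> {0..1} \<Longrightarrow> \<phi> x (s * t) \<le> A * s powr pl * \<phi> x t"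
    using low unfolding uniformly_lower_type_def by blast
  obtain B where B: "B > 0" "\<And>x t s. t \<ge> 0 \<Longrightarrow> s \<ge> 1 \<Longrightarrow> \<phi> x (s * t) \<le> B * s powr pu * \<phi> x t"
    using up unfolding uniformly_upper_type_def by blast
  define \<epsilon> where "\<epsilon> = min (pl - p1) (p2 - pu)"
  have \<epsilon>: "\<epsilon> > 0" "\<epsilon> \<le> pl - p1" "\<epsilon> \<le> p2 - pu"
    using p by (auto simp: \<epsilon>_def)
  obtain G where G: "G > 0"
    "\<And>a. (\<integral>\<^sup>+k. ennreal (2 powr (- \<epsilon> * \<bar>real_of_int k - a\<bar>)) \<partial>count_space UNIV) \<le> ennreal G"
    using two_sided_geometric_sum_bounded[OF \<epsilon>(1)] by blast
  define M where "M = 2 powr p1 * A + 2 powr p2 * B"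
  have M: "M > 0"
    using A(1) B(1) by (simp add: M_def add_pos_pos)
  have decay: "split_weight p1 p2 (u / t) * \<phi> x t \<le> M * 2 powr (- \<epsilon> * \<bar>log 2 t - log 2 u\<bar>) * \<phi> x u"
    if "t > 0" "u \<ge> 0" for x t u
    unfolding M_def by (rule split_weight_decay[OF orl A(2) A(1) B(2) B(1) \<epsilon>(2,3) that])
  have nonneg: "\<phi> x u \<ge> 0" if "u \<ge> 0" for x u
    using orlicz_nonneg[OF orl that] .
  show ?thesis
  proof (intro exI[of _ "M + M * G"] conjI allI impI)
    show "M + M * G > 0"
      using M G(1) by (simp add: add_pos_pos)
    show "split_weight p1 p2 (u / t) * \<phi> x t \<le> (M + M * G) * \<phi> x u" if "t > 0" "u \<ge> 0" for x t u
    proof -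
      have "2 powr (- \<epsilon> * \<bar>log 2 t - log 2 u\<bar>) \<le> 2 powr 0"
        using \<epsilon>(1) by (intro powr_mono) auto
      then have "M * 2 powr (- \<epsilon> * \<bar>log 2 t - log 2 u\<bar>) \<le> M * 1"
        using M by (intro mult_left_mono) auto
      also have "\<dots> \<le> M + M * G"
        using M G(1) by simp
      finally show ?thesis
        using decay[OF that, of x] nonneg[OF that(2)] by (meson mult_right_mono order_trans)
    qed
    show "(\<integral>\<^sup>+k. ennreal (split_weight p1 p2 (u / 2 powr real_of_int k) * \<phi> x (2 powr real_of_int k)) \<partial>count_space UNIV)
        \<le> ennreal ((M + M * G) * \<phi> x u)" if "u \<ge> 0" for x u
    proof -
      have "(\<integral>\<^sup>+k. ennreal (split_weight p1 p2 (u / 2 powr real_of_int k) * \<phi> x (2 powr real_of_int k)) \<partial>count_space UNIV)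
        \<le> (\<integral>\<^sup>+k. ennreal (M * \<phi> x u) * ennreal (2 powr (- \<epsilon> * \<bar>real_of_int k - log 2 u\<bar>)) \<partial>count_space UNIV)"
        using decay[of "2 powr real_of_int _" u x] that M nonneg[OF that]
        by (intro nn_integral_mono) (auto simp: ennreal_mult[symmetric] mult_ac intro!: ennreal_leI)
      also have "\<dots> = ennreal (M * \<phi> x u) *
          (\<integral>\<^sup>+k. ennreal (2 powr (- \<epsilon> * \<bar>real_of_int k - log 2 u\<bar>)) \<partial>count_space UNIV)"
        by (rule nn_integral_cmult) simp
      also have "\<dots> \<le> ennreal (M * \<phi> x u) * ennreal G"
        by (intro mult_left_mono G(2)) simp
      also have "\<dots> \<le> ennreal ((M + M * G) * \<phi> x u)"
        using M G(1) nonneg[OF that, of x]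
        by (auto simp: ennreal_mult[symmetric] algebra_simps intro!: ennreal_leI)
      finally show ?thesis .
    qed
  qed
qed

section \<open>Cutting a function at a height\<close>

lemma phi_measure_union_le:
  assumes "musielak_orlicz_function \<phi>" "t > 0" "E \<in> sets lebesgue" "F \<in> sets lebesgue"
    and "AE x in lebesgue. x \<in> D \<longrightarrow> x \<in> E \<or> x \<in> F"
  shows "phi_measure \<phi> D t \<le> phi_measure \<phi> E t + phi_measure \<phi> F t"
proof -
  have [measurable]: "(\<lambda>x. \<phi> x t) \<in> borel_measurable lebesgue"
    using assms(1,2) by (simp add: musielak_orlicz_function_def)
  have "phi_measure \<phi> D t \<le> (\<integral>\<^sup>+x. ennreal (\<phi> x t) * indicator E x + ennreal (\<phi> x t) * indicator F x \<partial>lebesgue)"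
    unfolding phi_measure_def using assms(5)
    by (intro nn_integral_mono_AE) (auto simp: indicator_def elim!: eventually_mono)
  also have "\<dots> = phi_measure \<phi> E t + phi_measure \<phi> F t"
    unfolding phi_measure_def using assms(3,4) by (intro nn_integral_add) auto
  finally show ?thesis .
qed

definition high_part :: "real \<Rightarrow> ('a \<Rightarrow> 'k::real_normed_vector) \<Rightarrow> 'a \<Rightarrow> 'k" where
  "high_part t f x = (if norm (f x) > t then f x else 0)"

definition low_part :: "real \<Rightarrow> ('a \<Rightarrow> 'k::real_normed_vector) \<Rightarrow> 'a \<Rightarrow> 'k" where
  "low_part t f x = (if norm (f x) > t then 0 else f x)"

lemma high_part_plus_low_part: "(\<lambda>x. high_part t f x + low_part t f x) = f"
  by (auto simp: high_part_def low_part_def)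

lemma high_part_measurable:
  assumes [measurable]: "f \<in> borel_measurable M"
  shows "(high_part t f :: 'a \<Rightarrow> 'k::euclidean_space) \<in> borel_measurable M"
  unfolding high_part_def[abs_def] by measurable

lemma low_part_measurable:
  assumes [measurable]: "f \<in> borel_measurable M"
  shows "(low_part t f :: 'a \<Rightarrow> 'k::euclidean_space) \<in> borel_measurable M"
  unfolding low_part_def[abs_def] by measurable

lemma halving_powr:
  fixes t a p :: real
  assumes "t > 0" "a \<ge> 0"
  shows "(t / 2) powr p * (2 * (a / t)) powr p = a powr p"
proof -
  have "(t / 2) powr p * (2 * (a / t)) powr p = (t / 2 * (2 * (a / t))) powr p"
    by (rule powr_mult[symmetric])
  then show ?thesis
    using assms by simp
qed

lemma high_part_powr_le:
  assumes "t > 0" "w \<ge> 0"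
  shows "norm (high_part t f x) powr p1 * w \<le> (t / 2) powr p1 * (split_weight p1 p2 (norm (f x) / t) * w)"
  using assms halving_powr[of t "norm (f x)" p1]
  by (auto simp: high_part_def split_weight_def mult.assoc[symmetric])

lemma low_part_powr_le:
  assumes "t > 0" "w \<ge> 0"
  shows "norm (low_part t f x) powr p2 * w \<le> (t / 2) powr p2 * (split_weight p1 p2 (norm (f x) / t) * w)"
  using assms halving_powr[of t "norm (f x)" p2]
  by (auto simp: low_part_def split_weight_def mult.assoc[symmetric])

text \<open>Common to both truncations. The hypotheses bound \<open>g\<close> against the weight \<open>\<phi>(\<cdot>, t)\<close> at the height \<open>t\<close>
  of the cut, whereas the space carries the weight \<open>\<phi>(\<cdot>, 1)\<close>; monotonicity (if \<open>t \<ge> 1\<close>) or the upper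
  type (if \<open>t < 1\<close>) bounds the latter by a multiple of the former, uniformly in \<open>x\<close>.\<close>

lemma truncated_mem_weighted_Lp:
  fixes \<phi> :: "real ^ 'n \<Rightarrow> real \<Rightarrow> real"
    and f g :: "real ^ 'n \<Rightarrow> 'k::{real_normed_field,euclidean_space}"
  assumes mo: "musielak_orlicz_function \<phi>" and up: "uniformly_upper_type \<phi> pu"
    and "t > 0" "K > 0"
    and K: "\<And>x. split_weight p1 p2 (norm (f x) / t) * \<phi> x t \<le> K * \<phi> x (norm (f x))"
    and f: "modular \<phi> f < \<infinity>" and g: "g \<in> borel_measurable lebesgue"
    and le: "\<And>x. norm (g x) powr p * \<phi> x t \<le> (t / 2) powr p * (split_weight p1 p2 (norm (f x) / t) * \<phi> x t)"
  shows "g \<in> weighted_Lp p (\<lambda>x. \<phi> x 1)"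
proof -
  have orl: "orlicz_function (\<phi> x)" for x
    using mo by (simp add: musielak_orlicz_function_def)
  have nonneg: "\<phi> x u \<ge> 0" if "u \<ge> 0" for x u
    using orlicz_nonneg[OF orl that] .
  obtain B where B: "B > 0" "\<And>x t s. t \<ge> 0 \<Longrightarrow> s \<ge> 1 \<Longrightarrow> \<phi> x (s * t) \<le> B * s powr pu * \<phi> x t"
    using up unfolding uniformly_upper_type_def by blast
  \<comment> \<open>1 serves for \<open>t \<ge> 1\<close>, the other summand for \<open>t < 1\<close>.\<close>
  define L where "L = 1 + B * (1 / t) powr pu"
  have L: "L > 0"
    using B(1) by (simp add: L_def add_pos_nonneg)
  have one_le: "\<phi> x 1 \<le> L * \<phi> x t" for x
  proof (cases "t \<ge> 1")
    case True
    then have "\<phi> x 1 \<le> 1 * \<phi> x t"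
      using orlicz_mono[OF orl] by simp
    also have "\<dots> \<le> L * \<phi> x t"
      using nonneg[of t x] \<open>t > 0\<close> B(1) by (intro mult_right_mono) (auto simp: L_def)
    finally show ?thesis .
  next
    case False
    then have "\<phi> x 1 \<le> B * (1 / t) powr pu * \<phi> x t"
      using B(2)[of t "1 / t" x] \<open>t > 0\<close> by simp
    also have "\<dots> \<le> L * \<phi> x t"
      using nonneg[of t x] \<open>t > 0\<close> B(1) by (intro mult_right_mono) (auto simp: L_def)
    finally show ?thesis .
  qed
  define c where "c = L * ((t / 2) powr p * K)"
  have c: "c > 0"
    using L \<open>K > 0\<close> \<open>t > 0\<close> by (simp add: c_def)
  have "norm (g x) powr p * \<phi> x 1 \<le> c * \<phi> x (norm (f x))" for x
  proof -
    have "norm (g x) powr p * \<phi> x 1 \<le> norm (g x) powr p * (L * \<phi> x t)"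
      by (intro mult_left_mono one_le) auto
    also have "\<dots> = L * (norm (g x) powr p * \<phi> x t)"
      by simp
    also have "\<dots> \<le> L * ((t / 2) powr p * (K * \<phi> x (norm (f x))))"
      using L by (intro mult_left_mono order_trans[OF le] K) auto
    finally show ?thesis
      by (simp add: c_def mult_ac)
  qed
  then have "(\<integral>\<^sup>+x. ennreal (norm (g x) powr p * \<phi> x 1) \<partial>lebesgue)
      \<le> (\<integral>\<^sup>+x. ennreal c * ennreal (\<phi> x (norm (f x))) \<partial>lebesgue)"
    using c nonneg by (intro nn_integral_mono) (auto simp: ennreal_mult[symmetric] intro!: ennreal_leI)
  also have "\<dots> \<le> ennreal c * modular \<phi> f"
    unfolding modular_def by (rule nn_integral_cmult_le_lower[OF c])
  also have "\<dots> < \<infinity>"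
    using f by (simp add: ennreal_mult_less_top)
  finally show ?thesis
    using g by (simp add: weighted_Lp_def)
qed

lemma zero_mem_weighted_Lp: "(\<lambda>x. 0) \<in> weighted_Lp p w"
  by (simp add: weighted_Lp_def)

lemma left_mem_space_sum:
  assumes "g \<in> V" "(\<lambda>x. 0) \<in> W"
  shows "g \<in> space_sum V W"
proof -
  have "\<exists>h. g = (\<lambda>x. g x + h x) \<and> g \<in> V \<and> h \<in> W"
    using assms by (intro exI[of _ "\<lambda>x. 0"]) simp
  then show ?thesis
    unfolding space_sum_def by blast
qed

lemma right_mem_space_sum:
  assumes "(\<lambda>x. 0) \<in> V" "h \<in> W"
  shows "h \<in> space_sum V W"
proof -
  have "\<exists>g. h = (\<lambda>x. g x + h x) \<and> g \<in> V \<and> h \<in> W"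
    using assms by (intro exI[of _ "\<lambda>x. 0"]) simp
  then show ?thesis
    unfolding space_sum_def by blast
qed

lemma musielak_orlicz_truncations:
  fixes \<phi> :: "real ^ 'n \<Rightarrow> real \<Rightarrow> real"
    and f :: "real ^ 'n \<Rightarrow> 'k::{real_normed_field,euclidean_space}"
  assumes mo: "musielak_orlicz_function \<phi>"
    and low: "uniformly_lower_type \<phi> pl" and up: "uniformly_upper_type \<phi> pu"
    and p: "p1 < pl" "pu < p2"
    and f: "f \<in> musielak_orlicz_space \<phi>" and "t > 0"
  shows "high_part t f \<in> weighted_Lp p1 (\<lambda>x. \<phi> x 1)" "low_part t f \<in> weighted_Lp p2 (\<lambda>x. \<phi> x 1)"
proof -
  obtain K where K: "K > 0"
    "\<forall>x. \<forall>t>0. \<forall>u\<ge>0. split_weight p1 p2 (u / t) * \<phi> x t \<le> K * \<phi> x u"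
    using split_weight_bound[OF mo low up p] by blast
  have f': "f \<in> borel_measurable lebesgue" "modular \<phi> f < \<infinity>"
    using f by (auto simp: musielak_orlicz_space_def)
  have nonneg: "\<phi> x t \<ge> 0" for x
    using mo \<open>t > 0\<close> by (auto simp: musielak_orlicz_function_def intro: orlicz_nonneg)
  show "high_part t f \<in> weighted_Lp p1 (\<lambda>x. \<phi> x 1)"
    by (rule truncated_mem_weighted_Lp[OF mo up \<open>t > 0\<close> K(1) K(2)[rule_format, OF \<open>t > 0\<close>] f'(2) high_part_measurable[OF f'(1)]])
      (auto intro: high_part_powr_le \<open>t > 0\<close> nonneg)
  show "low_part t f \<in> weighted_Lp p2 (\<lambda>x. \<phi> x 1)"
    by (rule truncated_mem_weighted_Lp[OF mo up \<open>t > 0\<close> K(1) K(2)[rule_format, OF \<open>t > 0\<close>] f'(2) low_part_measurable[OF f'(1)]])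
      (auto intro: low_part_powr_le \<open>t > 0\<close> nonneg)
qed

lemma musielak_orlicz_subset_space_sum:
  fixes \<phi> :: "real ^ 'n \<Rightarrow> real \<Rightarrow> real"
    and f :: "real ^ 'n \<Rightarrow> 'k::{real_normed_field,euclidean_space}"
  assumes "musielak_orlicz_function \<phi>"
    and "uniformly_lower_type \<phi> pl" and "uniformly_upper_type \<phi> pu"
    and "p1 < pl" "pu < p2"
    and "f \<in> musielak_orlicz_space \<phi>"
  shows "f \<in> space_sum (weighted_Lp p1 (\<lambda>x. \<phi> x 1)) (weighted_Lp p2 (\<lambda>x. \<phi> x 1))"
  unfolding space_sum_def
  using musielak_orlicz_truncations[OF assms, of 1] high_part_plus_low_part[of 1 f, symmetric] by auto

section \<open>Interpolation of the modular\<close>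

text \<open>Where \<open>norm (T f)\<close> exceeds \<open>t\<close>, the operator exceeds \<open>t / 2\<close> on one of the two parts of \<open>f\<close>, by
  sublinearity. The weak type of that part, taken at the level \<open>t / 2\<close> and with the weight \<open>\<phi>(\<cdot>, t)\<close> of the
  same height \<open>t\<close>, gives the bound; each part contributes one \<open>D\<close>.\<close>

lemma distribution_le_split_weight:
  fixes \<phi> :: "real ^ 'n \<Rightarrow> real \<Rightarrow> real"
    and T :: "(real ^ 'n \<Rightarrow> 'k::{real_normed_field,euclidean_space}) \<Rightarrow> (real ^ 'n \<Rightarrow> 'k)"
  assumes mo: "musielak_orlicz_function \<phi>"
    and low: "uniformly_lower_type \<phi> pl" and up: "uniformly_upper_type \<phi> pu"
    and p: "p1 < pl" "pu < p2"
    and T: "sublinear_operator_on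
           (space_sum (weighted_Lp p1 (\<lambda>x. \<phi> x 1)) (weighted_Lp p2 (\<lambda>x. \<phi> x 1))) T"
    and D: "D > 0"
    and weak_type: "\<And>p \<alpha> t f. p \<in> {p1, p2} \<Longrightarrow> \<alpha> > 0 \<Longrightarrow> t > 0 \<Longrightarrow> f \<in> weighted_Lp p (\<lambda>x. \<phi> x 1) \<Longrightarrow>
             phi_measure \<phi> {x. norm (T f x) > \<alpha>} t
               \<le> ennreal (D * \<alpha> powr (-p)) * (\<integral>\<^sup>+x. ennreal (norm (f x) powr p * \<phi> x t) \<partial>lebesgue)"
    and f: "f \<in> musielak_orlicz_space \<phi>" and "t > 0"
  shows "phi_measure \<phi> {x. norm (T f x) > t} t
    \<le> ennreal (2 * D) * (\<integral>\<^sup>+x. ennreal (split_weight p1 p2 (norm (f x) / t) * \<phi> x t) \<partial>lebesgue)"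
proof -
  let ?V = "space_sum (weighted_Lp p1 (\<lambda>x. \<phi> x 1)) (weighted_Lp p2 (\<lambda>x. \<phi> x 1))
              :: (real ^ 'n \<Rightarrow> 'k) set"
  let ?I = "\<integral>\<^sup>+x. ennreal (split_weight p1 p2 (norm (f x) / t) * \<phi> x t) \<partial>lebesgue"
  have [measurable]: "f \<in> borel_measurable lebesgue" "(\<lambda>x. \<phi> x t) \<in> borel_measurable lebesgue"
    using f mo \<open>t > 0\<close> by (auto simp: musielak_orlicz_space_def musielak_orlicz_function_def)
  have nonneg: "\<phi> x t \<ge> 0" for x
    using mo \<open>t > 0\<close> by (auto simp: musielak_orlicz_function_def intro: orlicz_nonneg)
  have mem: "high_part t f \<in> weighted_Lp p1 (\<lambda>x. \<phi> x 1)" "low_part t f \<in> weighted_Lp p2 (\<lambda>x. \<phi> x 1)"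
    using musielak_orlicz_truncations[OF mo low up p f \<open>t > 0\<close>] .
  then have V: "high_part t f \<in> ?V" "low_part t f \<in> ?V"
    by (auto intro: left_mem_space_sum right_mem_space_sum zero_mem_weighted_Lp)
  have [measurable]: "T (high_part t f) \<in> borel_measurable lebesgue" "T (low_part t f) \<in> borel_measurable lebesgue"
    using T V by (auto simp: sublinear_operator_on_def)
  have "AE x in lebesgue. norm (T (\<lambda>y. high_part t f y + low_part t f y) x) \<le> norm (T (high_part t f) x) + norm (T (low_part t f) x)"
    using T V by (auto simp: sublinear_operator_on_def)
  then have AE: "AE x in lebesgue. norm (T f x) \<le> norm (T (high_part t f) x) + norm (T (low_part t f) x)"
    by (simp add: high_part_plus_low_part)
  have piece: "phi_measure \<phi> {x. norm (T g x) > t / 2} t \<le> ennreal D * ?I"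
    if g: "p \<in> {p1, p2}" "g \<in> weighted_Lp p (\<lambda>x. \<phi> x 1)"
      "\<And>x. norm (g x) powr p * \<phi> x t \<le> (t / 2) powr p * (split_weight p1 p2 (norm (f x) / t) * \<phi> x t)"
    for g p
  proof -
    have "phi_measure \<phi> {x. norm (T g x) > t / 2} t
        \<le> ennreal (D * (t / 2) powr (-p)) * (\<integral>\<^sup>+x. ennreal (norm (g x) powr p * \<phi> x t) \<partial>lebesgue)"
      using g \<open>t > 0\<close> by (intro weak_type) auto
    also have "(\<integral>\<^sup>+x. ennreal (norm (g x) powr p * \<phi> x t) \<partial>lebesgue)
        \<le> (\<integral>\<^sup>+x. ennreal ((t / 2) powr p) * ennreal (split_weight p1 p2 (norm (f x) / t) * \<phi> x t) \<partial>lebesgue)"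
      using g(3) nonneg by (intro nn_integral_mono) (simp add: ennreal_mult[symmetric] ennreal_leI)
    also have "\<dots> = ennreal ((t / 2) powr p) * ?I"
      by (intro nn_integral_cmult) measurable
    finally have "phi_measure \<phi> {x. norm (T g x) > t / 2} t
        \<le> ennreal (D * (t / 2) powr (-p)) * (ennreal ((t / 2) powr p) * ?I)"
      by (simp add: mult_left_mono)
    also have "\<dots> = ennreal (D * ((t / 2) powr (-p) * (t / 2) powr p)) * ?I"
      using D by (simp only: mult.assoc[symmetric]) (simp add: ennreal_mult)
    also have "(t / 2) powr (-p) * (t / 2) powr p = 1"
      using \<open>t > 0\<close> by (simp flip: powr_add)
    finally show ?thesis by simp
  qed
  have "phi_measure \<phi> {x. norm (T f x) > t} t
      \<le> phi_measure \<phi> {x. norm (T (high_part t f) x) > t / 2} t + phi_measure \<phi> {x. norm (T (low_part t f) x) > t / 2} t"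
  proof (rule phi_measure_union_le[OF mo \<open>t > 0\<close>])
    show "AE x in lebesgue. x \<in> {x. norm (T f x) > t} \<longrightarrow>
        x \<in> {x. norm (T (high_part t f) x) > t / 2} \<or> x \<in> {x. norm (T (low_part t f) x) > t / 2}"
      using AE by (rule eventually_mono) auto
    have "{x \<in> space lebesgue. norm (T (high_part t f) x) > t / 2} \<in> sets lebesgue"
         "{x \<in> space lebesgue. norm (T (low_part t f) x) > t / 2} \<in> sets lebesgue"
      by measurable
    then show "{x. norm (T (high_part t f) x) > t / 2} \<in> sets lebesgue"
      "{x. norm (T (low_part t f) x) > t / 2} \<in> sets lebesgue"
      by simp_all
  qed
  also have "\<dots> \<le> ennreal D * ?I + ennreal D * ?I"
    using \<open>t > 0\<close> nonneg mem by (intro add_mono piece) (auto intro: high_part_powr_le low_part_powr_le)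
  also have "\<dots> = ennreal (2 * D) * ?I"
    using D by (simp add: distrib_right[symmetric] flip: ennreal_plus)
  finally show ?thesis .
qed

text \<open>Expand \<open>\<phi> x (norm (T f x))\<close> dyadically, exchange sum and integral, bound each level set, exchange
  back, and sum the weights pointwise.\<close>

lemma weak_type_imp_modular_bound:
  fixes \<phi> :: "real ^ 'n \<Rightarrow> real \<Rightarrow> real"
    and T :: "(real ^ 'n \<Rightarrow> 'k::{real_normed_field,euclidean_space}) \<Rightarrow> (real ^ 'n \<Rightarrow> 'k)"
  assumes mo: "musielak_orlicz_function \<phi>"
    and low: "uniformly_lower_type \<phi> pl" and up: "uniformly_upper_type \<phi> pu"
    and p: "p1 < pl" "pu < p2"
    and T: "sublinear_operator_on
           (space_sum (weighted_Lp p1 (\<lambda>x. \<phi> x 1)) (weighted_Lp p2 (\<lambda>x. \<phi> x 1))) T"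
    and weak_type: "\<And>p. p \<in> {p1, p2} \<Longrightarrow>
           \<exists>C>0. \<forall>\<alpha>>0. \<forall>t>0. \<forall>f\<in>weighted_Lp p (\<lambda>x. \<phi> x 1).
             phi_measure \<phi> {x. norm (T f x) > \<alpha>} t
               \<le> ennreal (C * \<alpha> powr (-p)) * (\<integral>\<^sup>+x. ennreal (norm (f x) powr p * \<phi> x t) \<partial>lebesgue)"
  shows "\<exists>C>0. \<forall>f\<in>musielak_orlicz_space \<phi>. modular \<phi> (T f) \<le> ennreal C * modular \<phi> f"
proof -
  have orl: "orlicz_function (\<phi> x)" for x
    using mo by (simp add: musielak_orlicz_function_def)
  have nonneg: "\<phi> x u \<ge> 0" if "u \<ge> 0" for x u
    using orlicz_nonneg[OF orl that] .
  have [measurable]: "(\<lambda>x. \<phi> x (2 powr real_of_int k)) \<in> borel_measurable lebesgue" for k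
    using mo by (simp add: musielak_orlicz_function_def)
  let ?weak = "\<lambda>p C. \<forall>\<alpha>>0. \<forall>t>0. \<forall>f\<in>weighted_Lp p (\<lambda>x. \<phi> x 1).
             phi_measure \<phi> {x. norm (T f x) > \<alpha>} t
               \<le> ennreal (C * \<alpha> powr (-p)) * (\<integral>\<^sup>+x. ennreal (norm (f x) powr p * \<phi> x t) \<partial>lebesgue)"
  obtain C1 where C1: "C1 > 0" "?weak p1 C1"
    using weak_type[of p1] by auto
  obtain C2 where C2: "?weak p2 C2"
    using weak_type[of p2] by auto
  define D where "D = max C1 C2"
  have D: "D > 0"
    using C1(1) by (auto simp: D_def less_max_iff_disj)
  have enlarge: "?weak p D" if "C \<le> D" "?weak p C" for p C
  proof (intro allI impI ballI)
    fix \<alpha> t :: real and f :: "real ^ 'n \<Rightarrow> 'k"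
    assume *: "\<alpha> > 0" "t > 0" "f \<in> weighted_Lp p (\<lambda>x. \<phi> x 1)"
    show "phi_measure \<phi> {x. norm (T f x) > \<alpha>} t
        \<le> ennreal (D * \<alpha> powr (-p)) * (\<integral>\<^sup>+x. ennreal (norm (f x) powr p * \<phi> x t) \<partial>lebesgue)"
      using that * by (intro order_trans[OF that(2)[rule_format, OF *]] mult_right_mono ennreal_leI) auto
  qed
  have "C1 \<le> D" "C2 \<le> D"
    by (simp_all add: D_def)
  then have "?weak p1 D" "?weak p2 D"
    using enlarge[OF _ C1(2)] enlarge[OF _ C2] by blast+
  then have weak: "phi_measure \<phi> {x. norm (T f x) > \<alpha>} t
      \<le> ennreal (D * \<alpha> powr (-p)) * (\<integral>\<^sup>+x. ennreal (norm (f x) powr p * \<phi> x t) \<partial>lebesgue)"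
    if "p \<in> {p1, p2}" "\<alpha> > 0" "t > 0" "f \<in> weighted_Lp p (\<lambda>x. \<phi> x 1)" for p \<alpha> t f
    using that by blast
  obtain B where B: "B > 0" "\<And>x t s. t \<ge> 0 \<Longrightarrow> s \<ge> 1 \<Longrightarrow> \<phi> x (s * t) \<le> B * s powr pu * \<phi> x t"
    using up unfolding uniformly_upper_type_def by blast
  obtain K where K: "K > 0"
    "\<forall>x. \<forall>u\<ge>0.
      (\<integral>\<^sup>+k. ennreal (split_weight p1 p2 (u / 2 powr real_of_int k) * \<phi> x (2 powr real_of_int k)) \<partial>count_space UNIV)
        \<le> ennreal (K * \<phi> x u)"
    using split_weight_bound[OF mo low up p] by blast
  define b where "b = B * 2 powr pu"
  have b: "b > 0"
    using B(1) by (simp add: b_def)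
  have "modular \<phi> (T f) \<le> ennreal (b * (2 * D * K)) * modular \<phi> f"
    if f: "f \<in> musielak_orlicz_space \<phi>" for f
  proof -
    have [measurable]: "f \<in> borel_measurable lebesgue"
      using f by (auto simp: musielak_orlicz_space_def)
    have [measurable]: "T f \<in> borel_measurable lebesgue"
      using T musielak_orlicz_subset_space_sum[OF mo low up p f]
      by (auto simp: sublinear_operator_on_def)
    let ?a = "\<lambda>k. 2 powr real_of_int k"
    let ?E = "\<lambda>k x. ennreal (\<phi> x (?a k)) * indicator {?a k<..} (norm (T f x))"
    let ?W = "\<lambda>k x. ennreal (split_weight p1 p2 (norm (f x) / ?a k) * \<phi> x (?a k))"
    have "modular \<phi> (T f) \<le> (\<integral>\<^sup>+x. ennreal b * (\<integral>\<^sup>+k. ?E k x \<partial>count_space UNIV) \<partial>lebesgue)"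
      unfolding modular_def b_def
      by (intro nn_integral_mono orlicz_le_dyadic_sum[OF orl B(2) B(1)]) auto
    also have "\<dots> \<le> ennreal b * (\<integral>\<^sup>+x. (\<integral>\<^sup>+k. ?E k x \<partial>count_space UNIV) \<partial>lebesgue)"
      by (rule nn_integral_cmult_le_lower[OF b])
    also have "(\<integral>\<^sup>+x. (\<integral>\<^sup>+k. ?E k x \<partial>count_space UNIV) \<partial>lebesgue)
        = (\<integral>\<^sup>+k. (\<integral>\<^sup>+x. ?E k x \<partial>lebesgue) \<partial>count_space UNIV)"
      by (rule nn_integral_count_space_nn_integral) auto
    also have "\<dots> = (\<integral>\<^sup>+k. phi_measure \<phi> {x. norm (T f x) > ?a k} (?a k) \<partial>count_space UNIV)"
      unfolding phi_measure_def by (intro nn_integral_cong) (simp add: indicator_def)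
    also have "\<dots> \<le> (\<integral>\<^sup>+k. ennreal (2 * D) * (\<integral>\<^sup>+x. ?W k x \<partial>lebesgue) \<partial>count_space UNIV)"
      by (intro nn_integral_mono distribution_le_split_weight[OF mo low up p T D weak f]) auto
    also have "\<dots> = ennreal (2 * D) * (\<integral>\<^sup>+k. (\<integral>\<^sup>+x. ?W k x \<partial>lebesgue) \<partial>count_space UNIV)"
      by (rule nn_integral_cmult) simp
    also have "(\<integral>\<^sup>+k. (\<integral>\<^sup>+x. ?W k x \<partial>lebesgue) \<partial>count_space UNIV)
        = (\<integral>\<^sup>+x. (\<integral>\<^sup>+k. ?W k x \<partial>count_space UNIV) \<partial>lebesgue)"
      by (rule nn_integral_count_space_nn_integral[symmetric]) auto
    also have "\<dots> \<le> (\<integral>\<^sup>+x. ennreal K * ennreal (\<phi> x (norm (f x))) \<partial>lebesgue)"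
      using K nonneg by (intro nn_integral_mono) (auto simp: ennreal_mult[symmetric])
    also have "\<dots> \<le> ennreal K * modular \<phi> f"
      unfolding modular_def by (rule nn_integral_cmult_le_lower[OF K(1)])
    finally have "modular \<phi> (T f) \<le> ennreal b * (ennreal (2 * D) * (ennreal K * modular \<phi> f))"
      by (simp add: mult_left_mono)
    also have "\<dots> = ennreal (b * (2 * D * K)) * modular \<phi> f"
      using b D K(1) by (simp add: ennreal_mult mult_ac)
    finally show ?thesis .
  qed
  then show ?thesis
    using b D K(1) by (intro exI[of _ "b * (2 * D * K)"]) auto
qed

section \<open>From the modular to the norm\<close>

text \<open>If the modular of \<open>f / r\<close> is at most 1, that of \<open>T f / r\<close> is at most \<open>C\<close> by homogeneity of \<open>T\<close>.
  Shrinking the argument by a further factor \<open>s\<close> multiplies the modular by at most \<open>A * s powr pl\<close>, so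
  because \<open>pl > 0\<close> a small \<open>s\<close> brings it below 1, and \<open>r / s\<close> is admissible for \<open>T f\<close>.\<close>

lemma modular_bound_imp_bounded:
  fixes \<phi> :: "real ^ 'n \<Rightarrow> real \<Rightarrow> real"
    and T :: "(real ^ 'n \<Rightarrow> 'k::{real_normed_field,euclidean_space}) \<Rightarrow> (real ^ 'n \<Rightarrow> 'k)"
  assumes mo: "musielak_orlicz_function \<phi>"
    and low: "uniformly_lower_type \<phi> pl" and "pl > 0"
    and T: "sublinear_operator_on V T" and V: "musielak_orlicz_space \<phi> \<subseteq> V"
    and modular_bound: "\<exists>C>0. \<forall>f\<in>musielak_orlicz_space \<phi>. modular \<phi> (T f) \<le> ennreal C * modular \<phi> f"
  shows "bounded_on_musielak_orlicz_space \<phi> T"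
proof -
  obtain C where C: "C > 0" "\<And>f. f \<in> musielak_orlicz_space \<phi> \<Longrightarrow> modular \<phi> (T f) \<le> ennreal C * modular \<phi> f"
    using modular_bound by blast
  obtain A where A: "A > 0" "\<And>x t s. t \<ge> 0 \<Longrightarrow> s \<in> {0..1} \<Longrightarrow> \<phi> x (s * t) \<le> A * s powr pl * \<phi> x t"
    using low unfolding uniformly_lower_type_def by blast
  have nonneg: "\<phi> x u \<ge> 0" if "u \<ge> 0" for x u
    using mo that by (auto simp: musielak_orlicz_function_def intro: orlicz_nonneg)
  \<comment> \<open>Chosen so that \<open>A * s powr pl * C \<le> 1\<close>; the minimum keeps \<open>s\<close> in the range of the lower type.\<close>
  define s where "s = min 1 ((1 / (A * C)) powr (1 / pl))"
  have s: "0 < s" "s \<le> 1"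
    using A(1) C(1) by (auto simp: s_def)
  have "s powr pl \<le> ((1 / (A * C)) powr (1 / pl)) powr pl"
    using s \<open>pl > 0\<close> by (intro powr_mono2) (auto simp: s_def)
  also have "\<dots> = 1 / (A * C)"
    using A(1) C(1) \<open>pl > 0\<close> by (simp add: powr_powr)
  finally have sAC: "A * s powr pl * C \<le> 1"
    using A(1) C(1) by (simp add: field_simps)
  have main: "T f \<in> musielak_orlicz_space \<phi> \<and>
      musielak_orlicz_norm \<phi> (T f) \<le> ennreal (1 / s) * musielak_orlicz_norm \<phi> f"
    if f: "f \<in> musielak_orlicz_space \<phi>" for f
  proof
    have f': "f \<in> borel_measurable lebesgue" "modular \<phi> f < \<infinity>"
      using f by (auto simp: musielak_orlicz_space_def)
    show "T f \<in> musielak_orlicz_space \<phi>"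
    proof -
      have "modular \<phi> (T f) < \<infinity>"
        by (rule le_less_trans[OF C(2)[OF f]]) (use f'(2) in \<open>simp add: ennreal_mult_less_top\<close>)
      then show ?thesis
        using T V f by (auto simp: musielak_orlicz_space_def sublinear_operator_on_def)
    qed
    have "ennreal s * musielak_orlicz_norm \<phi> (T f) \<le> ennreal r"
      if r: "r > 0" "(\<integral>\<^sup>+x. ennreal (\<phi> x (norm (f x) / r)) \<partial>lebesgue) \<le> 1" for r
    proof -
      define g where "g = (\<lambda>x. of_real (1 / r) * f x)"
      have norm_g: "norm (g x) = norm (f x) / r" for x
        using r(1) by (simp add: g_def norm_mult norm_divide)
      have mod_g: "modular \<phi> g \<le> 1"
        using r(2) by (simp add: modular_def norm_g)
      have "g \<in> borel_measurable lebesgue"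
        unfolding g_def using f'(1) by measurable
      then have g: "g \<in> musielak_orlicz_space \<phi>"
        using le_less_trans[OF mod_g, of \<infinity>] by (simp add: musielak_orlicz_space_def)
      have "AE x in lebesgue. norm (T (\<lambda>y. c * f y) x) = norm c * norm (T f x)" for c
        using T V f unfolding sublinear_operator_on_def by blast
      from this[of "of_real (1 / r)"]
      have "AE x in lebesgue. norm (T g x) = norm (of_real (1 / r) :: 'k) * norm (T f x)"
        unfolding g_def .
      then have Tg: "AE x in lebesgue. norm (T g x) = norm (T f x) / r"
        using r(1) by (simp add: norm_divide)
      have "(\<integral>\<^sup>+x. ennreal (\<phi> x (norm (T f x) / (r / s))) \<partial>lebesgue)
          \<le> (\<integral>\<^sup>+x. ennreal (A * s powr pl) * ennreal (\<phi> x (norm (T g x))) \<partial>lebesgue)"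
      proof (rule nn_integral_mono_AE, use Tg in \<open>rule eventually_mono\<close>)
        fix x assume "norm (T g x) = norm (T f x) / r"
        then have "norm (T f x) / (r / s) = s * norm (T g x)"
          by simp
        then have "\<phi> x (norm (T f x) / (r / s)) \<le> A * s powr pl * \<phi> x (norm (T g x))"
          using A(2)[of "norm (T g x)" s x] s by simp
        then show "ennreal (\<phi> x (norm (T f x) / (r / s))) \<le> ennreal (A * s powr pl) * ennreal (\<phi> x (norm (T g x)))"
          using A(1) nonneg by (simp add: ennreal_mult[symmetric] ennreal_leI)
      qed
      also have "\<dots> \<le> ennreal (A * s powr pl) * modular \<phi> (T g)"
        unfolding modular_def using A(1) s by (intro nn_integral_cmult_le_lower) auto
      also have "\<dots> \<le> ennreal (A * s powr pl) * (ennreal C * 1)"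
        using mod_g by (intro mult_left_mono order_trans[OF C(2)[OF g]]) auto
      also have "\<dots> = ennreal (A * s powr pl * C)"
        using A(1) C(1) by (simp add: ennreal_mult)
      also have "\<dots> \<le> ennreal 1"
        by (rule ennreal_leI[OF sAC])
      finally have "musielak_orlicz_norm \<phi> (T f) \<le> ennreal (r / s)"
        unfolding musielak_orlicz_norm_def using r(1) s(1) by (intro Inf_lower) auto
      then have "ennreal s * musielak_orlicz_norm \<phi> (T f) \<le> ennreal s * ennreal (r / s)"
        by (intro mult_left_mono) auto
      also have "\<dots> = ennreal r"
        using r(1) s(1) by (simp add: ennreal_mult[symmetric])
      finally show ?thesis .
    qed
    then have "ennreal s * musielak_orlicz_norm \<phi> (T f) \<le> musielak_orlicz_norm \<phi> f"
      unfolding musielak_orlicz_norm_def[of \<phi> f] by (intro Inf_greatest) auto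
    then have "ennreal (1 / s) * (ennreal s * musielak_orlicz_norm \<phi> (T f)) \<le> ennreal (1 / s) * musielak_orlicz_norm \<phi> f"
      by (intro mult_left_mono) auto
    then show "musielak_orlicz_norm \<phi> (T f) \<le> ennreal (1 / s) * musielak_orlicz_norm \<phi> f"
      using s(1) by (simp add: mult.assoc[symmetric] ennreal_mult[symmetric])
  qed
  then show ?thesis
    unfolding bounded_on_musielak_orlicz_space_def using s(1) by (intro exI[of _ "1 / s"]) auto
qed

section \<open>The interpolation theorem\<close>

theorem theorem2p7:
  fixes \<phi> :: "real ^ 'n \<Rightarrow> real \<Rightarrow> real"
    and T :: "(real ^ 'n \<Rightarrow> 'k::{real_normed_field,euclidean_space}) \<Rightarrow> (real ^ 'n \<Rightarrow> 'k)"
    and p1 p2 p_lower p_upper :: real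
  assumes "musielak_orlicz_function \<phi>"
    and "uniformly_lower_type \<phi> p_lower"
    and "uniformly_upper_type \<phi> p_upper"
    and "0 < p1" and "p1 < p_lower" and "p_lower \<le> p_upper" and "p_upper < p2"
    and "sublinear_operator_on
           (space_sum (weighted_Lp p1 (\<lambda>x. \<phi> x 1)) (weighted_Lp p2 (\<lambda>x. \<phi> x 1))) T"
    and weak_type: "\<And>p. p \<in> {p1, p2} \<Longrightarrow>
           \<exists>C>0. \<forall>\<alpha>>0. \<forall>t>0. \<forall>f\<in>weighted_Lp p (\<lambda>x. \<phi> x 1).
             phi_measure \<phi> {x. norm (T f x) > \<alpha>} t
               \<le> ennreal (C * \<alpha> powr (-p)) * (\<integral>\<^sup>+x. ennreal (norm (f x) powr p * \<phi> x t) \<partial>lebesgue)"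
  shows "bounded_on_musielak_orlicz_space \<phi> T \<and>
         (\<exists>C>0. \<forall>f\<in>musielak_orlicz_space \<phi>. modular \<phi> (T f) \<le> ennreal C * modular \<phi> f)"
proof -
  note hyps = assms(1-3,5,7)
  have modular_bound:
    "\<exists>C>0. \<forall>f\<in>musielak_orlicz_space \<phi>. modular \<phi> (T f) \<le> ennreal C * modular \<phi> f"
    by (rule weak_type_imp_modular_bound[OF hyps assms(8) weak_type])
  moreover have "bounded_on_musielak_orlicz_space \<phi> T"
  proof (rule modular_bound_imp_bounded[OF assms(1,2) _ assms(8) _ modular_bound])
    show "p_lower > 0"
      using assms(4,5) by simp
    show "musielak_orlicz_space \<phi> \<subseteq> space_sum (weighted_Lp p1 (\<lambda>x. \<phi> x 1)) (weighted_Lp p2 (\<lambda>x. \<phi> x 1))"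
      using musielak_orlicz_subset_space_sum[OF hyps] by blast
  qed
  ultimately show ?thesis
    by blast
qed

end
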